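(* Let $(A,\cdot,\alpha,R)$ be a Rota-Baxter Hom-associative algebra of weight $-1$ such that $\alpha$ and $R$ commute. Define the operation $\ast$ on $A$ by $$x\ast y=R(x)\cdot y-y\cdot R(x)-x\cdot y=[R(x),y]-x\cdot y.$$ Then $A_2=(A,\ast,\alpha)$ is a left Hom-preLie algebra.
   Context: $\mathbb{K}$ is a fixed field of characteristic $0$; all maps are $\mathbb{K}$-linear. A Hom-algebra $(A,\mu,\alpha)$ is a $\mathbb{K}$-module $A$ with a bilinear map $\mu\colon A\times A\to A$ and a linear map $\alpha\colon A\to A$ (not assumed multiplicative). The commutator bracket is $[x,y]=x\cdot y-y\cdot x$. A Hom-algebra $(A,\mu,\alpha)$ is Hom-associative if $\mu(\alpha(x),\mu(y,z))=\mu(\mu(x,y),\alpha(z))$ for all $x,y,z\in A$. A Rota-Baxter Hom-associative algebra of weight $\lambda\in\mathbb{K}$ is $(A,\cdot,\alpha,R)$ where $(A,\cdot,\alpha)$ is Hom-associative and $R\colon A\to A$ is linear with $R(x)\cdot R(y)=R(R(x)\cdot y+x\cdot R(y)+\lambda x\cdot y)$ for all $x,y\in A$. A left Hom-preLie algebra is a Hom-algebra $(A,\mu,\alpha)$ satisfying $\mu(\alpha(x),\mu(y,z))-\mu(\alpha(y),\mu(x,z))=\mu(\mu(x,y),\alpha(z))-\mu(\mu(y,x),\alpha(z))$ for all $x,y,z\in A$. *)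

theory Defs
  imports Complex_Main
begin

text \<open>
  The \<open>\<bbbK>\<close>-module is the whole type \<open>'a\<close>, with scalar multiplication \<open>scale\<close>.
  The twisting map \<open>\<alpha>\<close> is only linear; it is not assumed to be multiplicative.
\<close>

locale hom_algebra = vector_space scale
  for scale :: "'k::field_char_0 \<Rightarrow> 'a::ab_group_add \<Rightarrow> 'a" +
  fixes \<mu> :: "'a \<Rightarrow> 'a \<Rightarrow> 'a"
    and \<alpha> :: "'a \<Rightarrow> 'a"
  assumes linear_mult_left: "\<And>y. Vector_Spaces.linear scale scale (\<lambda>x. \<mu> x y)"
    and linear_mult_right: "\<And>x. Vector_Spaces.linear scale scale (\<lambda>y. \<mu> x y)"
    and linear_twist: "Vector_Spaces.linear scale scale \<alpha>"

locale hom_associative_algebra = hom_algebra +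
  assumes hom_assoc: "\<And>x y z. \<mu> (\<alpha> x) (\<mu> y z) = \<mu> (\<mu> x y) (\<alpha> z)"

locale rota_baxter_hom_associative_algebra = hom_associative_algebra scale \<mu> \<alpha>
  for scale :: "'k::field_char_0 \<Rightarrow> 'a::ab_group_add \<Rightarrow> 'a"
    and \<mu> :: "'a \<Rightarrow> 'a \<Rightarrow> 'a"
    and \<alpha> :: "'a \<Rightarrow> 'a" +
  fixes R :: "'a \<Rightarrow> 'a"
    and weight :: 'k
  assumes linear_R: "Vector_Spaces.linear scale scale R"
    and rota_baxter:
      "\<And>x y. \<mu> (R x) (R y) = R (\<mu> (R x) y + \<mu> x (R y) + scale weight (\<mu> x y))"

locale left_hom_preLie_algebra = hom_algebra +
  assumes left_hom_preLie:
    "\<And>x y z. \<mu> (\<alpha> x) (\<mu> y z) - \<mu> (\<alpha> y) (\<mu> x z)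
      = \<mu> (\<mu> x y) (\<alpha> z) - \<mu> (\<mu> y x) (\<alpha> z)"

definition commutator :: "('a::ab_group_add \<Rightarrow> 'a \<Rightarrow> 'a) \<Rightarrow> 'a \<Rightarrow> 'a \<Rightarrow> 'a"
  where "commutator \<mu> x y = \<mu> x y - \<mu> y x"

end

theory Submission
  imports Defs
begin

text \<open>
  In weight \<open>-1\<close> the Rota-Baxter identity says that \<open>R\<close> maps the commutator of \<open>\<ast>\<close> to the commutator
  \<open>[R x, R y]\<close>. Once \<open>R\<close> is eliminated in this way, Hom-associativity and \<open>\<alpha> R = R \<alpha>\<close> bring every
  term of the left Hom-preLie identity to the form \<open>(a \<cdot> b) \<cdot> \<alpha> c\<close>, and the two sides agree term by term.
\<close>

context hom_algebra
begin

lemmas mult_linear_simps =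
  module_hom.add[OF Vector_Spaces.linear.axioms(3)[OF linear_mult_left]]
  module_hom.diff[OF Vector_Spaces.linear.axioms(3)[OF linear_mult_left]]
  module_hom.scale[OF Vector_Spaces.linear.axioms(3)[OF linear_mult_left]]
  module_hom.add[OF Vector_Spaces.linear.axioms(3)[OF linear_mult_right]]
  module_hom.diff[OF Vector_Spaces.linear.axioms(3)[OF linear_mult_right]]
  module_hom.scale[OF Vector_Spaces.linear.axioms(3)[OF linear_mult_right]]

end

context rota_baxter_hom_associative_algebra
begin

lemmas R_linear_simps =
  module_hom.add[OF Vector_Spaces.linear.axioms(3)[OF linear_R]]
  module_hom.diff[OF Vector_Spaces.linear.axioms(3)[OF linear_R]]
  module_hom.scale[OF Vector_Spaces.linear.axioms(3)[OF linear_R]]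

definition induced_mult :: "'a \<Rightarrow> 'a \<Rightarrow> 'a"
  where "induced_mult x y = commutator \<mu> (R x) y - \<mu> x y"

lemma induced_mult_hom_algebra: "hom_algebra scale induced_mult \<alpha>"
proof (rule hom_algebra.intro[OF vector_space_axioms], rule hom_algebra_axioms.intro)
  fix y
  show "Vector_Spaces.linear scale scale (\<lambda>x. induced_mult x y)"
    by (rule Vector_Spaces.linear.intro[OF vector_space_axioms vector_space_axioms])
      (unfold_locales, simp_all add: induced_mult_def commutator_def mult_linear_simps
        R_linear_simps scale_right_diff_distrib)
next
  fix x
  show "Vector_Spaces.linear scale scale (induced_mult x)"
    by (rule Vector_Spaces.linear.intro[OF vector_space_axioms vector_space_axioms])
      (unfold_locales, simp_all add: induced_mult_def commutator_def mult_linear_simps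
        scale_right_diff_distrib)
qed (rule linear_twist)

text \<open>The six terms of the commutator regroup as \<open>(R x \<cdot> y + x \<cdot> R y - x
  \<cdot> y) - (R y \<cdot> x + y \<cdot> R x - y \<cdot> x)\<close>. In weight -1 the two groups
  are the arguments of \<open>R\<close> in the Rota-Baxter identity for \<open>(x, y)\<close> and
  \<open>(y, x)\<close>.\<close>

lemma R_commutator_induced_mult:
  assumes "weight = - 1"
  shows "R (commutator induced_mult x y) = commutator \<mu> (R x) (R y)"
  by (simp add: rota_baxter assms induced_mult_def commutator_def R_linear_simps algebra_simps)

lemma induced_mult_left_hom_preLie:
  assumes weight: "weight = - 1" and commute: "\<And>x. R (\<alpha> x) = \<alpha> (R x)"
  shows "left_hom_preLie_algebra scale induced_mult \<alpha>"
proof (rule left_hom_preLie_algebra.intro[OF induced_mult_hom_algebra], unfold_locales)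
  fix x y z
  interpret induced: hom_algebra scale induced_mult \<alpha>
    by (rule induced_mult_hom_algebra)
  \<comment> \<open>By linearity in the first factor, the right-hand side depends on
    \<open>x\<close> and \<open>y\<close> only through \<open>?c\<close>. Keeping \<open>?c\<close>
    folded leaves \<open>R ?c\<close> in the shape that \<open>R_commutator_induced_mult\<close>
    rewrites.\<close>
  let ?c = "commutator induced_mult x y"
  have "induced_mult (induced_mult x y) (\<alpha> z) - induced_mult (induced_mult y x) (\<alpha> z)
      = induced_mult ?c (\<alpha> z)"
    by (simp add: commutator_def induced.mult_linear_simps)
  also have "\<dots> = commutator \<mu> (commutator \<mu> (R x) (R y)) (\<alpha> z) - \<mu> ?c (\<alpha> z)"
    by (simp add: induced_mult_def[of ?c] R_commutator_induced_mult[OF weight])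
  \<comment> \<open>Expanded and reassociated, the terms
    \<open>(R x \<cdot> z) \<cdot> \<alpha> (R y)\<close> and
    \<open>(x \<cdot> z) \<cdot> \<alpha> (R y)\<close>, and those with \<open>x\<close> and
    \<open>y\<close> exchanged, cancel. Terms ending in \<open>\<alpha> z\<close> give the products
    with \<open>\<alpha> z\<close> on the right; terms starting with \<open>z\<close> give
    \<open>\<alpha> z \<cdot> [R x, R y]\<close>.\<close>
  also have "\<dots> = induced_mult (\<alpha> x) (induced_mult y z) - induced_mult (\<alpha> y) (induced_mult x z)"
    by (simp add: induced_mult_def commutator_def commute mult_linear_simps hom_assoc)
  finally show "induced_mult (\<alpha> x) (induced_mult y z) - induced_mult (\<alpha> y) (induced_mult x z)
      = induced_mult (induced_mult x y) (\<alpha> z) - induced_mult (induced_mult y x) (\<alpha> z)"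
    by simp
qed

end

theorem theorem4p2:
  fixes scale :: "'k::field_char_0 \<Rightarrow> 'a::ab_group_add \<Rightarrow> 'a"
    and \<mu> :: "'a \<Rightarrow> 'a \<Rightarrow> 'a"
    and \<alpha> R :: "'a \<Rightarrow> 'a"
    and ast :: "'a \<Rightarrow> 'a \<Rightarrow> 'a"
  assumes "rota_baxter_hom_associative_algebra scale \<mu> \<alpha> R (- 1)"
    and "\<alpha> \<circ> R = R \<circ> \<alpha>"
    and "\<And>x y. ast x y = \<mu> (R x) y - \<mu> y (R x) - \<mu> x y"
  shows "(\<forall>x y. ast x y = commutator \<mu> (R x) y - \<mu> x y) \<and>
    left_hom_preLie_algebra scale ast \<alpha>"
proof -
  interpret rota_baxter_hom_associative_algebra scale \<mu> \<alpha> R "- 1"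
    by (rule assms(1))
  \<comment> \<open>Equality as functions, not just of values, carries the structure proved for
    \<open>induced_mult\<close> over to \<open>ast\<close>.\<close>
  have ast: "ast = induced_mult"
    by (intro ext) (simp add: assms(3) induced_mult_def commutator_def)
  have "R (\<alpha> x) = \<alpha> (R x)" for x
    using fun_cong[OF assms(2), of x] by simp
  then show ?thesis
    using induced_mult_left_hom_preLie by (simp add: ast induced_mult_def)
qed

end
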